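(* Let $\delta=2+\sqrt[3]{2}$. For every constant $e>0$, problem $\overline{\mathcal{W}}(1,ed)$ admits a solution by algorithm $\mathrm{Naive}(s,r)$ with speeds: if $e<\delta$, $s=\sqrt{\frac{e}{2(1+2^{2/3})}}$ and $r=\sqrt{\frac{e}{2+2^{1/3}}}$; if $\delta\le e<4$, $s=\sqrt{\frac{e-2}{2}}$ and $r=1$; if $e\ge4$, $s=r=1$. The induced evacuation time on instance $d$ is $g(e)\,d$, where $g(e)=\sqrt{\frac{(2+2^{1/3})^3}{e}}$ for $e<\delta$, $g(e)=2+\sqrt{\frac{2}{e-2}}$ for $\delta\le e<4$, and $g(e)=3$ for $e\ge4$.
   Context: Two robots start at the origin of the infinite real line. An exit is placed at an unknown point at distance $d>0$ from the origin (either at $d$ or at $-d$; either placement is called an instance $d$). A robot finds the exit if and only if it walks over it. Robots may change speed and direction at any time, and communicate wirelessly: messages are transmitted instantaneously at any distance. The evacuation time is the time at which the last robot reaches the exit. A robot moving at constant speed $s$ over a segment of length $x$ uses energy $xs^2$, and energies of successive intervals add up. The total evacuation energy is the sum of the two robots' energies used until both have reached the exit. Problem $\overline{\mathcal{W}}(1,ed)$: minimize the evacuation time over algorithms using speeds at most $1$ whose total evacuation energy is at most $ed$ for every instance $d$ (the algorithm does not know $d$ but knows $e$). Algorithm $\mathrm{Naive}(s,r)$: the two robots move in opposite directions with speed $s$ until the exit is found; the finder announces "exit found" and halts; the other robot turns around and moves at speed $r$ until it reaches the exit. *)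

theory Defs
  imports "HOL-Analysis.Analysis"
begin

datatype robot = R1 | R2

text \<open>
  \<open>moves b p t u E\<close>: during the time interval from \<open>t\<close> to \<open>u\<close>, the position function \<open>p\<close>
  decomposes into finitely many successive intervals of constant velocity, each of speed at
  most \<open>b\<close>, and the motion uses energy \<open>E\<close>: an interval of length \<open>x\<close> covered at speed \<open>s\<close>
  contributes \<open>x * s\<^sup>2\<close>. The closed intervals force \<open>p\<close> to be continuous.
\<close>

inductive moves :: "real \<Rightarrow> (real \<Rightarrow> real) \<Rightarrow> real \<Rightarrow> real \<Rightarrow> real \<Rightarrow> bool"
  for b :: real and p :: "real \<Rightarrow> real" and t :: real where
  start: "moves b p t t 0"
| step: "moves b p t u E \<Longrightarrow> u \<le> w \<Longrightarrow> \<bar>v\<bar> \<le> b \<Longrightarrow>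
    (\<And>\<tau>. \<tau> \<in> {u..w} \<Longrightarrow> p \<tau> = p u + v * (\<tau> - u)) \<Longrightarrow>
    moves b p t w (E + \<bar>p w - p u\<bar> * \<bar>v\<bar>\<^sup>2)"

text \<open>
  A deterministic online algorithm for two robots with wireless communication.
  \<open>search A j\<close> is the trajectory of robot \<open>j\<close> as long as no exit has been announced; it cannot
  depend on the exit. If the exit is found at position \<open>x\<close> at time \<open>t\<close>, both robots know this
  immediately, and \<open>respond A x t j u\<close> is the position of robot \<open>j\<close> at times \<open>u > t\<close>.
\<close>

record algorithm =
  search :: "robot \<Rightarrow> real \<Rightarrow> real"
  respond :: "real \<Rightarrow> real \<Rightarrow> robot \<Rightarrow> real \<Rightarrow> real"

definition first_time :: "(real \<Rightarrow> bool) \<Rightarrow> real \<Rightarrow> bool" where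
  "first_time P t \<longleftrightarrow> 0 \<le> t \<and> P t \<and> (\<forall>u. 0 \<le> u \<and> u < t \<longrightarrow> \<not> P u)"

definition found_at :: "algorithm \<Rightarrow> real \<Rightarrow> real \<Rightarrow> bool" where
  "found_at A x t \<longleftrightarrow> first_time (\<lambda>u. \<exists>j. search A j u = x) t"

definition trajectory :: "algorithm \<Rightarrow> real \<Rightarrow> real \<Rightarrow> robot \<Rightarrow> real \<Rightarrow> real" where
  "trajectory A x t j u = (if u \<le> t then search A j u else respond A x t j u)"

definition evac_time :: "algorithm \<Rightarrow> real \<Rightarrow> real \<Rightarrow> bool" where
  "evac_time A x T \<longleftrightarrow> (\<exists>t T1 T2. found_at A x t \<and>
     first_time (\<lambda>u. trajectory A x t R1 u = x) T1 \<and>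
     first_time (\<lambda>u. trajectory A x t R2 u = x) T2 \<and> T = max T1 T2)"

definition evac_energy :: "real \<Rightarrow> algorithm \<Rightarrow> real \<Rightarrow> real \<Rightarrow> bool" where
  "evac_energy b A x E \<longleftrightarrow> (\<exists>t T E1 E2. found_at A x t \<and> evac_time A x T \<and>
     moves b (trajectory A x t R1) 0 T E1 \<and> moves b (trajectory A x t R2) 0 T E2 \<and> E = E1 + E2)"

text \<open>
  \<open>solves b \<Delta> A\<close>: \<open>A\<close> is a feasible solution of the problem of evacuating with speeds at most \<open>b\<close>
  and total energy at most \<open>\<Delta> d\<close>, for each exit at distance \<open>d\<close> on either side of the origin.
\<close>

definition solves :: "real \<Rightarrow> (real \<Rightarrow> real) \<Rightarrow> algorithm \<Rightarrow> bool" where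
  "solves b \<Delta> A \<longleftrightarrow> (\<forall>j. search A j 0 = 0) \<and>
     (\<forall>d>0. \<forall>x\<in>{d, - d}. \<exists>E. evac_energy b A x E \<and> E \<le> \<Delta> d)"

definition naive_search :: "real \<Rightarrow> robot \<Rightarrow> real \<Rightarrow> real" where
  "naive_search s j u = (case j of R1 \<Rightarrow> s * u | R2 \<Rightarrow> - (s * u))"

text \<open>The finder is the robot standing at \<open>x\<close> at time \<open>t\<close>.\<close>

definition naive_respond :: "real \<Rightarrow> real \<Rightarrow> real \<Rightarrow> real \<Rightarrow> robot \<Rightarrow> real \<Rightarrow> real" where
  "naive_respond s r x t j u = (let p = naive_search s j t in
     if p = x then x
     else if r * (u - t) \<le> \<bar>x - p\<bar> then p + sgn (x - p) * (r * (u - t))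
     else x)"

definition naive :: "real \<Rightarrow> real \<Rightarrow> algorithm" where
  "naive s r = \<lparr>search = naive_search s, respond = naive_respond s r\<rparr>"

definition delta :: real where
  "delta = 2 + root 3 2"

definition speed_s :: "real \<Rightarrow> real" where
  "speed_s e = (if e < delta then sqrt (e / (2 * (1 + 2 powr (2/3))))
     else if e < 4 then sqrt ((e - 2) / 2) else 1)"

definition speed_r :: "real \<Rightarrow> real" where
  "speed_r e = (if e < delta then sqrt (e / (2 + 2 powr (1/3))) else 1)"

definition time_factor :: "real \<Rightarrow> real" where
  "time_factor e = (if e < delta then sqrt ((2 + 2 powr (1/3)) ^ 3 / e)
     else if e < 4 then 2 + sqrt (2 / (e - 2)) else 3)"

text \<open>The relations above are functional, so they do define \<^emph>\<open>the\<close> time and \<^emph>\<open>the\<close> energy.\<close>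

lemma first_time_unique: "first_time P t \<Longrightarrow> first_time P u \<Longrightarrow> t = u"
  unfolding first_time_def by (metis linorder_neqE_linordered_idom)

lemma moves_has_integral:
  assumes "moves b p t u E"
  shows "t \<le> u \<and> ((\<lambda>\<tau>. \<bar>deriv p \<tau>\<bar> ^ 3) has_integral E) {t..u}"
  using assms
proof induction
  case start
  show ?case using has_integral_refl(2)[of _ t] by simp
next
  case (step u E w v)
  have eq: "deriv p x = v" if "x \<in> {u<..<w}" for x
  proof (rule DERIV_imp_deriv, rule has_field_derivative_transform_within_open)
    show "((\<lambda>\<tau>. p u + v * (\<tau> - u)) has_field_derivative v) (at x)"
      by (auto intro!: derivative_eq_intros)
    show "open {u<..<w}" by simp
    show "x \<in> {u<..<w}" by fact
    show "p u + v * (y - u) = p y" if "y \<in> {u<..<w}" for y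
      using step(4)[of y] that by simp
  qed
  have "((\<lambda>_. \<bar>v\<bar> ^ 3) has_integral (w - u) * \<bar>v\<bar> ^ 3) {u..w}"
    using has_integral_const_real[of "\<bar>v\<bar> ^ 3" u w] \<open>u \<le> w\<close> by simp
  then have "((\<lambda>\<tau>. \<bar>deriv p \<tau>\<bar> ^ 3) has_integral (w - u) * \<bar>v\<bar> ^ 3) {u..w}"
    by (rule has_integral_spike_finite[of "{u, w}", rotated 2]) (auto simp: eq)
  moreover have "(w - u) * \<bar>v\<bar> ^ 3 = \<bar>p w - p u\<bar> * \<bar>v\<bar>\<^sup>2"
    using step(4)[of w] \<open>u \<le> w\<close> by (simp add: abs_mult power3_eq_cube power2_eq_square)
  ultimately show ?case
    using step.IH \<open>u \<le> w\<close> by (auto intro!: has_integral_combine[where c = u])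
qed

lemma moves_unique: "moves b p t u E \<Longrightarrow> moves b p t u F \<Longrightarrow> E = F"
  using moves_has_integral has_integral_unique by blast

lemma evac_time_unique: "evac_time A x T \<Longrightarrow> evac_time A x U \<Longrightarrow> T = U"
  unfolding evac_time_def found_at_def by (metis first_time_unique)

lemma evac_energy_unique: "evac_energy b A x E \<Longrightarrow> evac_energy b A x F \<Longrightarrow> E = F"
  unfolding evac_energy_def found_at_def
  by (metis first_time_unique evac_time_unique moves_unique)

end

theory Submission
  imports Defs
begin

text \<open>
  For an exit at distance \<open>d\<close>, the finder arrives at time \<open>d / s\<close>, when the other robot is \<open>2 d\<close>
  away. So Naive evacuates in time \<open>d / s + 2 d / r\<close>, using energy \<open>2 s\<^sup>2 d + 2 r\<^sup>2 d\<close>. For small \<open>e\<close>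
  the speeds satisfy \<open>r = c s\<close> with \<open>c = 2 powr (1/3)\<close>, and the stated constants come out
  of these two formulas through \<open>c ^ 3 = 2\<close>.
\<close>

text \<open>The sign of the half-line that each robot searches. Writing the exit as
  \<open>side k * d\<close> makes robot \<open>k\<close> its finder, so both placements of the exit
  are treated at once.\<close>

fun side :: "robot \<Rightarrow> real" where
  "side R1 = 1"
| "side R2 = - 1"

lemma abs_side [simp]: "\<bar>side k\<bar> = 1"
  by (cases k) auto

lemma side_other: "j \<noteq> k \<Longrightarrow> side j = - side k"
  by (cases j; cases k) auto

lemma naive_search_eq: "naive_search s j u = side j * (s * u)"
  by (cases j) (auto simp: naive_search_def)

lemma trajectory_naive_finder:
  assumes "s > 0"
  shows "trajectory (naive s r) (side k * d) (d / s) k u =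
    (if u \<le> d / s then side k * (s * u) else side k * d)"
  using assms
  by (simp add: trajectory_def naive_def naive_search_eq naive_respond_def)

text \<open>At time \<open>d / s\<close> this robot stands at the mirror image of the exit. The gap
  is therefore \<open>2 * d\<close>, which is the threshold separating the return from the
  halt.\<close>

lemma trajectory_naive_other:
  assumes "s > 0" "d > 0" "j \<noteq> k"
  shows "trajectory (naive s r) (side k * d) (d / s) j u =
    (if u \<le> d / s then - side k * (s * u)
     else if r * (u - d / s) \<le> 2 * d then - side k * (d - r * (u - d / s))
     else side k * d)"
  using assms side_other[OF assms(3)]
  by (cases k) (auto simp: trajectory_def naive_def naive_search_eq naive_respond_def Let_def
      algebra_simps)

lemma found_at_naive:
  assumes "s > 0" "d > 0"
  shows "found_at (naive s r) (side k * d) (d / s)"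
proof -
  have "side j * (s * u) \<noteq> side k * d" if "0 \<le> u" "u < d / s" for j u
  proof -
    \<comment> \<open>Both robots are still at distance \<open>s * u\<close> from the origin, too
      close for either side.\<close>
    have "0 \<le> s * u" "s * u < d"
      using that assms by (auto simp: field_simps)
    then show ?thesis
      by (cases j; cases k) auto
  qed
  moreover have "side k * (s * (d / s)) = side k * d"
    using assms by simp
  ultimately show ?thesis
    using assms unfolding found_at_def first_time_def
    by (auto simp: naive_def naive_search_eq)
qed

lemma first_time_naive_finder:
  assumes "s > 0" "d > 0"
  shows "first_time (\<lambda>u. trajectory (naive s r) (side k * d) (d / s) k u = side k * d) (d / s)"
  using assms unfolding first_time_def trajectory_naive_finder[OF assms(1)]
  by (cases k) (auto simp: field_simps)

lemma first_time_naive_other: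
  assumes "s > 0" "r > 0" "d > 0" "j \<noteq> k"
  shows "first_time (\<lambda>u. trajectory (naive s r) (side k * d) (d / s) j u = side k * d)
    (d / s + 2 * d / r)"
proof -
  let ?p = "trajectory (naive s r) (side k * d) (d / s) j"
  have "?p u \<noteq> side k * d" if "0 \<le> u" "u < d / s + 2 * d / r" for u
  proof -
    \<comment> \<open>This bound keeps the return phase short of the exit; the next one keeps the
      search phase on the wrong half-line.\<close>
    have "r * (u - d / s) < 2 * d"
      using that assms by (simp add: field_simps)
    moreover have "0 \<le> s * u"
      using that assms by simp
    ultimately show ?thesis
      using assms(3) unfolding trajectory_naive_other[OF assms(1,3,4)]
      by (cases k) auto
  qed
  \<comment> \<open>Arrival falls under the return branch, with
    \<open>r * (u - d / s) = 2 * d\<close> exactly.\<close>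
  moreover have "?p (d / s + 2 * d / r) = side k * d"
    using assms unfolding trajectory_naive_other[OF assms(1,3,4)]
    by (simp add: divide_le_0_iff)
  ultimately show ?thesis
    using assms unfolding first_time_def by simp
qed

lemma evac_time_naive:
  assumes "s > 0" "r > 0" "d > 0"
  shows "evac_time (naive s r) (side k * d) (d / s + 2 * d / r)"
proof -
  \<comment> \<open>This settles the \<open>max\<close> in \<open>evac_time\<close>: the finder is
    never the last to arrive.\<close>
  have le: "d / s \<le> d / s + 2 * d / r"
    using assms by simp
  show ?thesis
  proof (cases k)
    case R1
    show ?thesis
      unfolding evac_time_def
      using found_at_naive[OF assms(1,3), of r k] first_time_naive_finder[OF assms(1,3), of r k]
        first_time_naive_other[OF assms, of R2 k] le
      by (intro exI[of _ "d / s"] exI[of _ "d / s + 2 * d / r"]) (simp add: R1)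
  next
    case R2
    show ?thesis
      unfolding evac_time_def
      using found_at_naive[OF assms(1,3), of r k] first_time_naive_finder[OF assms(1,3), of r k]
        first_time_naive_other[OF assms, of R1 k] le
      by (intro exI[of _ "d / s"] exI[of _ "d / s + 2 * d / r"]) (simp add: R2)
  qed
qed

text \<open>A velocity \<open>v\<close> held for time \<open>t\<close> covers
  \<open>t * \<bar>v\<bar>\<close> at cost \<open>\<bar>v\<bar>\<^sup>2\<close> per unit of length.
  This gives the energy in terms of durations, with cubes of speeds.\<close>

lemma moves_two_steps:
  assumes "0 \<le> t" "t \<le> T" "\<bar>v\<bar> \<le> b" "\<bar>w\<bar> \<le> b"
    and "\<And>u. 0 \<le> u \<Longrightarrow> u \<le> t \<Longrightarrow> p u = p 0 + v * u"
    and "\<And>u. t \<le> u \<Longrightarrow> u \<le> T \<Longrightarrow> p u = p t + w * (u - t)"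
  shows "moves b p 0 T (t * \<bar>v\<bar> ^ 3 + (T - t) * \<bar>w\<bar> ^ 3)"
proof -
  have "moves b p 0 t (0 + \<bar>p t - p 0\<bar> * \<bar>v\<bar>\<^sup>2)"
    by (rule moves.step[OF moves.start]) (use assms(1,3) in simp_all, rule assms(5), simp_all)
  then have "moves b p 0 T (0 + \<bar>p t - p 0\<bar> * \<bar>v\<bar>\<^sup>2 + \<bar>p T - p t\<bar> * \<bar>w\<bar>\<^sup>2)"
    by (rule moves.step) (use assms(2,4) in simp_all, rule assms(6), simp_all)
  moreover have "\<bar>p t - p 0\<bar> * \<bar>v\<bar>\<^sup>2 = t * \<bar>v\<bar> ^ 3"
    using assms(1) assms(5)[of t] by (simp add: abs_mult power3_eq_cube power2_eq_square)
  moreover have "\<bar>p T - p t\<bar> * \<bar>w\<bar>\<^sup>2 = (T - t) * \<bar>w\<bar> ^ 3"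
    using assms(2) assms(6)[of T] by (simp add: abs_mult power3_eq_cube power2_eq_square)
  ultimately show ?thesis
    by simp
qed

lemma moves_naive_finder:
  assumes "s > 0" "r > 0" "d > 0" "s \<le> b"
  shows "moves b (trajectory (naive s r) (side k * d) (d / s) k) 0 (d / s + 2 * d / r) (s\<^sup>2 * d)"
proof -
  \<comment> \<open>Energy is measured up to the common time \<open>T\<close>; the finder waits with
    velocity 0, which is free.\<close>
  have "moves b (trajectory (naive s r) (side k * d) (d / s) k) 0 (d / s + 2 * d / r)
    (d / s * \<bar>side k * s\<bar> ^ 3 + (d / s + 2 * d / r - d / s) * \<bar>0\<bar> ^ 3)"
    using assms
    by (intro moves_two_steps) (auto simp: trajectory_naive_finder abs_mult)
  then show ?thesis
    using assms by (simp add: abs_mult power3_eq_cube power2_eq_square mult_ac)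
qed

lemma moves_naive_other:
  assumes "s > 0" "r > 0" "d > 0" "s \<le> b" "r \<le> b" "j \<noteq> k"
  shows "moves b (trajectory (naive s r) (side k * d) (d / s) j) 0 (d / s + 2 * d / r)
    (s\<^sup>2 * d + 2 * r\<^sup>2 * d)"
proof -
  \<comment> \<open>The halt branch never occurs up to the final time, so the motion has just two
    linear pieces, outward and back.\<close>
  have "r * (u - d / s) \<le> 2 * d" if "u \<le> d / s + 2 * d / r" for u
    using that assms by (simp add: field_simps)
  then have "moves b (trajectory (naive s r) (side k * d) (d / s) j) 0 (d / s + 2 * d / r)
    (d / s * \<bar>- side k * s\<bar> ^ 3 + (d / s + 2 * d / r - d / s) * \<bar>side k * r\<bar> ^ 3)"
    using assms
    by (intro moves_two_steps) (auto simp: trajectory_naive_other abs_mult, auto simp: algebra_simps)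
  then show ?thesis
    using assms by (simp add: abs_mult power3_eq_cube power2_eq_square mult_ac)
qed

lemma evac_energy_naive:
  assumes "s > 0" "r > 0" "d > 0" "s \<le> b" "r \<le> b"
  shows "evac_energy b (naive s r) (side k * d) ((2 * s\<^sup>2 + 2 * r\<^sup>2) * d)"
proof -
  obtain E1 E2 where
    "moves b (trajectory (naive s r) (side k * d) (d / s) R1) 0 (d / s + 2 * d / r) E1"
    "moves b (trajectory (naive s r) (side k * d) (d / s) R2) 0 (d / s + 2 * d / r) E2"
    "(2 * s\<^sup>2 + 2 * r\<^sup>2) * d = E1 + E2"
  proof (cases k)
    case R1
    show ?thesis
      using that moves_naive_finder[OF assms(1-4), of k] moves_naive_other[OF assms, of R2 k]
      by (simp add: R1 algebra_simps)
  next
    case R2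
    show ?thesis
      using that moves_naive_finder[OF assms(1-4), of k] moves_naive_other[OF assms, of R1 k]
      by (simp add: R2 algebra_simps)
  qed
  then show ?thesis
    unfolding evac_energy_def
    using found_at_naive[OF assms(1,3)] evac_time_naive[OF assms(1-3)] by blast
qed

text \<open>Energy and budget are both linear in \<open>d\<close>, so one comparison of coefficients
  covers all instances.\<close>

lemma naive_solves:
  assumes "s > 0" "r > 0" "s \<le> b" "r \<le> b" "2 * s\<^sup>2 + 2 * r\<^sup>2 \<le> e"
  shows "solves b (\<lambda>d. e * d) (naive s r)"
proof -
  have "\<exists>E. evac_energy b (naive s r) x E \<and> E \<le> e * d" if "d > 0" "x \<in> {d, - d}" for d x
  proof -
    have "x = side R1 * d \<or> x = side R2 * d"
      using that by auto
    then have "evac_energy b (naive s r) x ((2 * s\<^sup>2 + 2 * r\<^sup>2) * d)"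
      using evac_energy_naive[OF assms(1,2) that(1) assms(3,4)] by metis
    moreover have "(2 * s\<^sup>2 + 2 * r\<^sup>2) * d \<le> e * d"
      using assms(5) that(1) by (simp add: mult_right_mono)
    ultimately show ?thesis
      by blast
  qed
  moreover have "search (naive s r) j 0 = 0" for j
    by (simp add: naive_def naive_search_eq)
  ultimately show ?thesis
    unfolding solves_def by blast
qed

text \<open>The ratio \<open>c\<close> of the two speeds comes from making
  \<open>1 / s + 2 / r\<close> stationary subject to
  \<open>2 * s\<^sup>2 + 2 * r\<^sup>2 = e\<close>, which yields
  \<open>r ^ 3 = 2 * s ^ 3\<close>.\<close>

lemma small_budget_speeds:
  fixes e :: real
  assumes "e > 0" "e < delta"
  defines "c \<equiv> 2 powr (1/3)"
  shows "speed_r e > 0" "speed_r e \<le> 1" "speed_s e = speed_r e / c" "1 < c"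
    "2 * (1 + c\<^sup>2) = (2 + c) * c\<^sup>2" "(speed_r e)\<^sup>2 = e / (2 + c)"
    "time_factor e = (2 + c) / speed_r e"
proof -
  have c3: "c ^ 3 = 2"
    by (simp add: c_def powr_power)
  show c1: "1 < c"
    by (simp add: c_def)
  \<comment> \<open>Hence \<open>e < delta\<close> says precisely that
    \<open>e / (2 + c) < 1\<close>, which keeps \<open>speed_r e\<close> below the speed
    limit.\<close>
  have delta: "delta = 2 + c"
    by (simp add: delta_def c_def root_powr_inverse)
  have c2: "2 powr (2/3) = c\<^sup>2"
    by (simp add: c_def powr_power)
  have r: "speed_r e = sqrt (e / (2 + c))"
    using assms by (simp add: speed_r_def)
  show "speed_r e > 0" "speed_r e \<le> 1" "(speed_r e)\<^sup>2 = e / (2 + c)"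
    using assms(1,2) c1 by (simp_all add: r delta)
  show "2 * (1 + c\<^sup>2) = (2 + c) * c\<^sup>2"
    using c3 by (simp add: power3_eq_cube power2_eq_square algebra_simps)
  then show "speed_s e = speed_r e / c"
    using assms(2) c1 by (simp add: speed_s_def c2 r real_sqrt_divide real_sqrt_mult)
  \<comment> \<open>Splitting off a square lets one factor \<open>2 + c\<close> leave the root; what
    remains is the reciprocal of \<open>speed_r e\<close>.\<close>
  have "(2 + c) ^ 3 = (2 + c)\<^sup>2 * (2 + c)"
    by (simp add: power3_eq_cube power2_eq_square)
  then show "time_factor e = (2 + c) / speed_r e"
    using assms(2) c1 by (simp add: time_factor_def r real_sqrt_divide real_sqrt_mult flip: c_def)
qed

lemma speeds_feasible:
  assumes "e > 0"
  shows "0 < speed_s e" "speed_s e \<le> 1" "0 < speed_r e" "speed_r e \<le> 1"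
    "2 * (speed_s e)\<^sup>2 + 2 * (speed_r e)\<^sup>2 \<le> e"
    "time_factor e = 1 / speed_s e + 2 / speed_r e"
proof -
  have "0 < speed_s e \<and> speed_s e \<le> 1 \<and> 0 < speed_r e \<and> speed_r e \<le> 1 \<and>
    2 * (speed_s e)\<^sup>2 + 2 * (speed_r e)\<^sup>2 \<le> e \<and>
    time_factor e = 1 / speed_s e + 2 / speed_r e"
  proof (cases "e < delta")
    case True
    define c :: real where "c = 2 powr (1/3)"
    note speeds = small_budget_speeds[OF assms True, folded c_def]
    \<comment> \<open>Over the common denominator \<open>c\<^sup>2\<close> the numerator becomes
      \<open>(2 + c) * c\<^sup>2 * (speed_r e)\<^sup>2\<close>, so the budget is used up
      exactly.\<close>
    have "2 * (speed_s e)\<^sup>2 + 2 * (speed_r e)\<^sup>2 = 2 * (1 + c\<^sup>2) * (speed_r e)\<^sup>2 / c\<^sup>2"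
      using speeds(4) by (simp add: speeds(3) power_divide field_simps)
    also have "2 * (1 + c\<^sup>2) = (2 + c) * c\<^sup>2"
      by (fact speeds(5))
    finally have "2 * (speed_s e)\<^sup>2 + 2 * (speed_r e)\<^sup>2 = e"
      using speeds(4) by (simp add: speeds(6))
    moreover have "speed_r e / c \<le> 1"
      using speeds(2,4) by (simp add: field_simps)
    ultimately show ?thesis
      using speeds by (simp add: add_divide_distrib)
  next
    case False
    \<comment> \<open>This makes \<open>(e - 2) / 2\<close> positive. For \<open>e < 4\<close> the
      energy is then \<open>(e - 2) + 2 = e\<close>; for larger \<open>e\<close> it is
      \<open>4\<close>.\<close>
    then have "e > 2"
      by (simp add: delta_def) (smt (verit) real_root_gt_zero zero_less_numeral)
    then show ?thesis
      using False
      by (auto simp: speed_s_def speed_r_def time_factor_def real_sqrt_divide power_divide,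
          simp add: field_simps)
  qed
  then show "0 < speed_s e" "speed_s e \<le> 1" "0 < speed_r e" "speed_r e \<le> 1"
    "2 * (speed_s e)\<^sup>2 + 2 * (speed_r e)\<^sup>2 \<le> e"
    "time_factor e = 1 / speed_s e + 2 / speed_r e"
    by auto
qed

theorem theorem6:
  fixes e :: real
  assumes "e > 0"
  shows "solves 1 (\<lambda>d. e * d) (naive (speed_s e) (speed_r e)) \<and>
    (\<forall>d>0. \<forall>x\<in>{d, - d}. evac_time (naive (speed_s e) (speed_r e)) x (time_factor e * d))"
proof (intro conjI allI impI ballI)
  note speeds = speeds_feasible[OF assms]
  show "solves 1 (\<lambda>d. e * d) (naive (speed_s e) (speed_r e))"
    using naive_solves speeds by blast
  fix d x :: real
  assume "d > 0" and x: "x \<in> {d, - d}"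
  have "time_factor e * d = d / speed_s e + 2 * d / speed_r e"
    by (simp add: speeds(6) distrib_right)
  \<comment> \<open>Each placement of the exit has its own finder, so the side form covers
    both.\<close>
  moreover have "x = side R1 * d \<or> x = side R2 * d"
    using x by auto
  ultimately show "evac_time (naive (speed_s e) (speed_r e)) x (time_factor e * d)"
    using evac_time_naive[OF speeds(1,3) \<open>d > 0\<close>] by metis
qed

end
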